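(* The function $p$ has an $L_f$-Lipschitz continuous gradient, i.e. $p$ is differentiable and $\|\nabla p(x)-\nabla p(y)\|_*\le L_f\|x-y\|$ for all $x,y\in\mathbb{E}$.
   Context: $\mathbb{E}$ is an $n$-dimensional real vector space, $\mathbb{E}^*$ its dual, $\langle s,x\rangle$ the value of $s\in\mathbb{E}^*$ at $x\in\mathbb{E}$. $B:\mathbb{E}\to\mathbb{E}^*$ is a symmetric positive definite linear operator, $\|x\|=\sqrt{\langle Bx,x\rangle}$ on $\mathbb{E}$ and $\|g\|_*=\sqrt{\langle g,B^{-1}g\rangle}$ on $\mathbb{E}^*$. $f:\mathbb{E}\to\mathbb{R}$ is convex and differentiable, with gradient Lipschitz continuous with constant $L_f>0$ (i.e. $\|\nabla f(x)-\nabla f(y)\|_*\le L_f\|x-y\|$). Points $z_1,\dots,z_m\in\mathbb{E}$ ($m\ge1$) are given, with $f_i=f(z_i)$, $g_i=\nabla f(z_i)$. Define $\phi(y,g)=\max_{i=1,\dots,m}\left\{f_i+\langle g_i,y-z_i\rangle+\frac{1}{2L_f}\|g-g_i\|_*^2\right\}$ and $p(y)=\min_{g\in\mathbb{E}^*}\phi(y,g)$ for $y\in\mathbb{E}$, $g\in\mathbb{E}^*$. *)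

theory Defs
  imports "HOL-Analysis.Analysis"
begin

text \<open>The primal space is a type \<open>'a :: euclidean_space\<close>, used only as a finite-dimensional real vector
  space: its built-in inner product does not enter the definitions below. Its dual is
  \<open>'a \<Rightarrow>\<^sub>L real\<close> (in finite dimension every linear functional is bounded), the pairing being
  \<^const>\<open>blinfun_apply\<close>. All norms in the statement are those induced by \<open>B\<close>, not the library's
  \<^const>\<open>norm\<close>; differentiability does not depend on this choice in finite dimension.\<close>

definition sym_pos_def :: "('a::euclidean_space \<Rightarrow> ('a \<Rightarrow>\<^sub>L real)) \<Rightarrow> bool" where
  "sym_pos_def B \<longleftrightarrow> linear B
     \<and> (\<forall>x y. blinfun_apply (B x) y = blinfun_apply (B y) x)
     \<and> (\<forall>x. x \<noteq> 0 \<longrightarrow> blinfun_apply (B x) x > 0)"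

definition primal_norm :: "('a::euclidean_space \<Rightarrow> ('a \<Rightarrow>\<^sub>L real)) \<Rightarrow> 'a \<Rightarrow> real" where
  "primal_norm B x = sqrt (blinfun_apply (B x) x)"

definition dual_norm :: "('a::euclidean_space \<Rightarrow> ('a \<Rightarrow>\<^sub>L real)) \<Rightarrow> ('a \<Rightarrow>\<^sub>L real) \<Rightarrow> real" where
  "dual_norm B g = sqrt (blinfun_apply g (inv B g))"

text \<open>The gradient is an element of the dual space, namely the derivative itself. It is meaningful
  only where \<open>f\<close> is differentiable.\<close>

definition gradient :: "('a::euclidean_space \<Rightarrow> real) \<Rightarrow> 'a \<Rightarrow> ('a \<Rightarrow>\<^sub>L real)" where
  "gradient f x = Blinfun (frechet_derivative f (at x))"

definition phi ::
  "('a::euclidean_space \<Rightarrow> ('a \<Rightarrow>\<^sub>L real)) \<Rightarrow> ('a \<Rightarrow> real) \<Rightarrow> real \<Rightarrow> nat \<Rightarrow> (nat \<Rightarrow> 'a)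
    \<Rightarrow> 'a \<Rightarrow> ('a \<Rightarrow>\<^sub>L real) \<Rightarrow> real" where
  "phi B f L m z y g =
     (MAX i\<in>{1..m}. f (z i) + blinfun_apply (gradient f (z i)) (y - z i)
                     + 1 / (2 * L) * (dual_norm B (g - gradient f (z i)))\<^sup>2)"

text \<open>\<open>LEAST\<close> denotes the minimum of the values of \<^const>\<open>phi\<close> over all \<open>g\<close>, and is unspecified
  unless that minimum is attained.\<close>

definition p_model ::
  "('a::euclidean_space \<Rightarrow> ('a \<Rightarrow>\<^sub>L real)) \<Rightarrow> ('a \<Rightarrow> real) \<Rightarrow> real \<Rightarrow> nat \<Rightarrow> (nat \<Rightarrow> 'a)
    \<Rightarrow> 'a \<Rightarrow> real" where
  "p_model B f L m z y = (LEAST v. v \<in> range (phi B f L m z y))"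

end

theory Submission
  imports Defs
begin

text \<open>Substituting \<open>g = L B(y - u)\<close> turns \<open>\<phi>(y, g)\<close> into \<open>h(u) + L/2 \<parallel>y - u\<parallel>\<^sup>2\<close>, where
  \<open>h(u) = max\<^sub>i (\<langle>g\<^sub>i, u\<rangle> + c\<^sub>i)\<close>, with constants \<open>c\<^sub>i\<close>, is convex. Hence \<open>p\<close> is the Moreau envelope of \<open>h\<close>. If \<open>u(y)\<close> is the
  minimizer, then \<open>g(y) = L B(y - u(y))\<close> is a subgradient of \<open>h\<close> at \<open>u(y)\<close>, and this gives
  \<open>p(y) + \<langle>g(y), x - y\<rangle> + \<parallel>g(x) - g(y)\<parallel>\<^sub>*\<^sup>2/(2L) \<le> p(x) \<le> p(y) + \<langle>g(y), x - y\<rangle> + L/2 \<parallel>x - y\<parallel>\<^sup>2\<close>.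
  So \<open>g(y)\<close> is the gradient of \<open>p\<close> at \<open>y\<close>, and exchanging the roles of \<open>x\<close> and \<open>y\<close> in the lower
  bound yields co-coercivity of the gradient, hence its Lipschitz continuity.\<close>

section \<open>Differentiability from quadratic error bounds; convexity of maxima of affine
  functions\<close>

lemma has_derivative_if_quadratic_error:
  fixes p :: "'a::real_normed_vector \<Rightarrow> real" and g :: "'a \<Rightarrow>\<^sub>L real"
  assumes bound: "\<And>x. \<bar>p x - p y - blinfun_apply g (x - y)\<bar> \<le> C * (norm (x - y))\<^sup>2"
  shows "(p has_derivative blinfun_apply g) (at y)"
proof (rule has_derivativeI)
  show "bounded_linear (blinfun_apply g)"
    by (rule blinfun.bounded_linear_right)
  have "((\<lambda>x. C * norm (x - y)) \<longlongrightarrow> C * norm (y - y)) (at y)"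
    by (intro tendsto_intros)
  then have lim: "((\<lambda>x. C * norm (x - y)) \<longlongrightarrow> 0) (at y)"
    by simp
  have "norm ((p x - p y - blinfun_apply g (x - y)) /\<^sub>R norm (x - y)) \<le> C * norm (x - y)"
    if "x \<noteq> y" for x
  proof -
    from that have "norm (x - y) > 0" by simp
    then show ?thesis
      using bound[of x] by (simp add: field_simps power2_eq_square)
  qed
  then show "((\<lambda>x. (p x - p y - blinfun_apply g (x - y)) /\<^sub>R norm (x - y)) \<longlongrightarrow> 0) (at y)"
    by (intro Lim_null_comparison[OF _ lim]) (auto simp: eventually_at_filter)
qed

lemma gradient_eqI:
  assumes "(p has_derivative blinfun_apply g) (at y)"
  shows "gradient p y = g"
  by (simp add: gradient_def blinfun_apply_inverse flip: frechet_derivative_at[OF assms])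

lemma convex_on_Max_affine:
  fixes a :: "'i \<Rightarrow> 'a::real_normed_vector \<Rightarrow>\<^sub>L real" and c :: "'i \<Rightarrow> real"
  assumes I: "finite I" "I \<noteq> {}"
  shows "convex_on UNIV (\<lambda>u. MAX i\<in>I. blinfun_apply (a i) u + c i)"
proof (rule convex_onI)
  fix t :: real and u v :: 'a
  assume t: "0 < t" "t < 1"
  let ?h = "\<lambda>u. MAX i\<in>I. blinfun_apply (a i) u + c i"
  have "blinfun_apply (a i) ((1 - t) *\<^sub>R u + t *\<^sub>R v) + c i \<le> (1 - t) * ?h u + t * ?h v"
    if "i \<in> I" for i
  proof -
    have "blinfun_apply (a i) u + c i \<le> ?h u" "blinfun_apply (a i) v + c i \<le> ?h v"
      using I that by (auto intro: Max_ge)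
    then have "(1 - t) * (blinfun_apply (a i) u + c i) + t * (blinfun_apply (a i) v + c i)
        \<le> (1 - t) * ?h u + t * ?h v"
      using t by (intro add_mono mult_left_mono) auto
    then show ?thesis
      by (simp add: blinfun.bilinear_simps algebra_simps)
  qed
  then show "?h ((1 - t) *\<^sub>R u + t *\<^sub>R v) \<le> (1 - t) * ?h u + t * ?h v"
    using I by simp
qed auto

section \<open>The Euclidean structure induced by \<open>B\<close>\<close>

locale euclidean_metric =
  fixes B :: "'a::euclidean_space \<Rightarrow> ('a \<Rightarrow>\<^sub>L real)"
  assumes spd: "sym_pos_def B"
begin

lemma linear_B: "linear B"
  using spd by (simp add: sym_pos_def_def)

lemma B_commute: "blinfun_apply (B x) y = blinfun_apply (B y) x"
  using spd by (simp add: sym_pos_def_def)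

lemma B_pos: "x \<noteq> 0 \<Longrightarrow> 0 < blinfun_apply (B x) x"
  using spd by (simp add: sym_pos_def_def)

lemmas B_simps = linear_add[OF linear_B] linear_diff[OF linear_B] linear_cmul[OF linear_B]
  linear_0[OF linear_B] linear_neg[OF linear_B] blinfun.bilinear_simps

lemma B_nonneg: "0 \<le> blinfun_apply (B x) x"
  using B_pos[of x] by (cases "x = 0") (auto simp: B_simps)

lemma inj_B: "inj B"
proof (rule linear_injective_0[OF linear_B, THEN iffD2], intro allI impI)
  fix x assume "B x = 0"
  then show "x = 0" using B_pos[of x] by auto
qed

text \<open>Injectivity forces surjectivity by equality of dimensions. Reading off the coordinates
  of \<open>B x\<close> on \<open>Basis\<close> gives an endomorphism \<open>T\<close> of the primal
  space, to which this argument applies.\<close>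

lemma surj_B: "surj B"
proof -
  define T where "T x = (\<Sum>i\<in>Basis. blinfun_apply (B x) i *\<^sub>R i)" for x :: 'a
  have linT: "linear T"
    unfolding T_def
    by (rule linearI) (simp_all add: B_simps scaleR_add_left sum.distrib scaleR_sum_right)
  have T_inner: "T x \<bullet> i = blinfun_apply (B x) i" if "i \<in> Basis" for x i
    using that by (simp add: T_def)
  have "inj T"
  proof (rule linear_injective_0[OF linT, THEN iffD2], intro allI impI)
    fix x assume "T x = 0"
    then have "B x = B 0"
      using T_inner[of _ x] by (intro blinfun_euclidean_eqI) (simp add: B_simps)
    then show "x = 0" using inj_B by (auto dest: injD)
  qed
  with linT have surjT: "surj T"
    by (simp add: linear_injective_imp_surjective)
  have "\<exists>x. B x = g" for g
  proof -
    obtain x where x: "T x = (\<Sum>i\<in>Basis. blinfun_apply g i *\<^sub>R i)"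
      using surjT by (metis surjD)
    have "B x = g"
      by (rule blinfun_euclidean_eqI) (simp add: x flip: T_inner)
    then show ?thesis ..
  qed
  then show ?thesis by (metis surjI)
qed

text \<open>Together with \<open>surj_B\<close>, this reduces every computation with the dual norm
  to the quadratic form of \<open>B\<close>.\<close>

lemma dual_norm_B: "dual_norm B (B x) = primal_norm B x"
  by (simp add: dual_norm_def primal_norm_def inj_B)

lemma primal_norm_power2: "(primal_norm B x)\<^sup>2 = blinfun_apply (B x) x"
  by (simp add: primal_norm_def B_nonneg)

text \<open>Converts error terms measured by \<open>B\<close> into the library norm, in which
  \<open>has_derivative\<close> is formulated.\<close>

lemma B_le_norm_power2:
  obtains K where "\<And>x. blinfun_apply (B x) x \<le> K * (norm x)\<^sup>2"
proof -
  have "bounded_linear B"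
    using linear_B by (simp add: linear_conv_bounded_linear)
  then obtain K where K: "\<And>x. norm (B x) \<le> norm x * K"
    using bounded_linear.bounded by blast
  have "blinfun_apply (B x) x \<le> K * (norm x)\<^sup>2" for x
  proof -
    have "blinfun_apply (B x) x \<le> norm (B x) * norm x"
      using norm_blinfun[of "B x" x] by simp
    also have "\<dots> \<le> (norm x * K) * norm x"
      by (intro mult_right_mono K) auto
    finally show ?thesis by (simp add: power2_eq_square mult_ac)
  qed
  then show ?thesis using that by blast
qed

lemma continuous_on_B: "continuous_on S (\<lambda>x. blinfun_apply (B x) x)"
proof -
  have "continuous_on S B"
    using linear_B linear_continuous_on linear_conv_bounded_linear by blast
  then show ?thesis by (intro continuous_intros)
qed

text \<open>The quadratic form attains a positive minimum on the compact unit sphere, and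
  homogeneity extends the bound to all vectors. It supplies the coercivity behind the existence of
  minimizers.\<close>

lemma B_ge_norm_power2:
  obtains c where "c > 0" "\<And>x. c * (norm x)\<^sup>2 \<le> blinfun_apply (B x) x"
proof -
  have e: "(SOME i. i \<in> Basis) \<in> sphere (0::'a) 1"
    by (simp add: SOME_Basis)
  obtain w where w: "w \<in> sphere 0 1"
      and min: "\<And>x. x \<in> sphere 0 1 \<Longrightarrow> blinfun_apply (B w) w \<le> blinfun_apply (B x) x"
    using continuous_attains_inf[OF compact_sphere _ continuous_on_B] e by (metis empty_iff)
  have "blinfun_apply (B w) w * (norm x)\<^sup>2 \<le> blinfun_apply (B x) x" for x
  proof (cases "x = 0")
    case False
    have "blinfun_apply (B w) w
        \<le> blinfun_apply (B ((1 / norm x) *\<^sub>R x)) ((1 / norm x) *\<^sub>R x)"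
      using False by (intro min) simp
    also have "\<dots> = blinfun_apply (B x) x / (norm x)\<^sup>2"
      by (simp add: B_simps power2_eq_square)
    finally show ?thesis using False by (simp add: field_simps)
  qed (simp add: B_simps)
  moreover have "0 < blinfun_apply (B w) w"
    using w by (intro B_pos) auto
  ultimately show ?thesis using that by blast
qed

section \<open>Proximal points: existence and optimality condition\<close>

lemma prox_exists:
  fixes h :: "'a \<Rightarrow> real"
  assumes cont: "continuous_on UNIV h" and L: "L > 0"
    and minorant: "\<And>u. blinfun_apply l u + a \<le> h u"
  obtains u where "\<And>v. h u + L / 2 * blinfun_apply (B (y - u)) (y - u)
      \<le> h v + L / 2 * blinfun_apply (B (y - v)) (y - v)"
proof -
  define F where "F v = h v + L / 2 * blinfun_apply (B (y - v)) (y - v)" for v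
  obtain c where c: "c > 0" and c_le: "\<And>x. c * (norm x)\<^sup>2 \<le> blinfun_apply (B x) x"
    using B_ge_norm_power2 by blast
  define s where "s = L * c / 2"
  have s: "s > 0" using L c by (simp add: s_def)
  define d where "d = h y - a - blinfun_apply l y"
  have d: "d \<ge> 0" using minorant[of y] by (simp add: d_def)
  \<comment> \<open>Here \<open>d\<close> is the gap between \<open>h\<close> and its affine
    minorant at \<open>y\<close>. For \<open>r > R\<close> the choice of \<open>R\<close> gives
    \<open>norm l + d \<le> s * r\<close>, and the summand 1 ensures \<open>r \<ge> 1\<close>, hence
    \<open>d \<le> r * d\<close>.\<close>
  define R where "R = (norm l + d) / s + 1"
  have R: "R \<ge> 1" using s d by (simp add: R_def)
  have contF: "continuous_on S F" for S
  proof -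
    have "continuous_on S (\<lambda>v. blinfun_apply (B (y - v)) (y - v))"
      by (rule continuous_on_compose2[OF continuous_on_B[of UNIV], of S "\<lambda>v. y - v"])
        (auto intro!: continuous_intros)
    then show ?thesis
      unfolding F_def
      by (intro continuous_on_add continuous_on_mult_left continuous_on_subset[OF cont]) auto
  qed
  have "cball y R \<noteq> {}" using R by simp
  then obtain u where u: "\<And>v. v \<in> cball y R \<Longrightarrow> F u \<le> F v"
    using continuous_attains_inf[OF compact_cball _ contF] by blast
  \<comment> \<open>Outside the ball the quadratic term dominates the minorant, so
    \<open>F v\<close> is at least \<open>h y = F y\<close>, and \<open>y\<close> itself lies in the
    ball.\<close>
  have "F u \<le> F v" for v
  proof (cases "v \<in> cball y R")
    case False
    define r where "r = norm (v - y)"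
    have r: "r > R" using False by (simp add: r_def dist_norm norm_minus_commute)
    have "s * R \<ge> norm l + d"
      using s by (simp add: R_def field_simps)
    then have "norm l + d \<le> s * r"
      using mult_left_mono[of R r s] r s by linarith
    then have "r * (norm l + d) \<le> r * (s * r)"
      using r R by (intro mult_left_mono) auto
    moreover have "d \<le> r * d"
      using r R d by (simp add: mult_le_cancel_right1)
    ultimately have rd: "d \<le> s * r\<^sup>2 - norm l * r"
      by (simp add: algebra_simps power2_eq_square)
    have "- (norm l * r) \<le> blinfun_apply l (v - y)"
      using norm_blinfun[of l "v - y"] by (simp add: r_def)
    then have "- (norm l * r) + blinfun_apply l y + a \<le> h v"
      using minorant[of v] by (simp add: blinfun.diff_right)
    moreover have "s * r\<^sup>2 \<le> L / 2 * blinfun_apply (B (y - v)) (y - v)"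
      using mult_left_mono[OF c_le[of "y - v"], of "L / 2"] L
      by (simp add: s_def r_def norm_minus_commute)
    ultimately have "h y \<le> F v"
      using rd by (simp add: F_def d_def)
    moreover have "F u \<le> h y"
      using u[of y] R by (simp add: F_def B_simps)
    ultimately show ?thesis by simp
  qed (rule u)
  then show ?thesis using that unfolding F_def by blast
qed

text \<open>Compare \<open>u\<close> with points on the segment towards \<open>v\<close>. Minimality
  and convexity bound the increment below by zero; after division by the step length
  \<open>t\<close>, the quadratic term vanishes as \<open>t\<close> tends to 0.\<close>

lemma prox_subgradient:
  assumes conv: "convex_on UNIV h"
    and min: "\<And>v. h u + L / 2 * blinfun_apply (B (y - u)) (y - u)
      \<le> h v + L / 2 * blinfun_apply (B (y - v)) (y - v)"
  shows "h u + L * blinfun_apply (B (y - u)) (v - u) \<le> h v"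
proof -
  define s where "s = h v - h u - L * blinfun_apply (B (y - u)) (v - u)"
  define q where "q = L / 2 * blinfun_apply (B (v - u)) (v - u)"
  have "0 \<le> s + t * q" if t: "0 < t" "t < 1" for t
  proof -
    define n where "n = (1 - t) *\<^sub>R u + t *\<^sub>R v"
    have le: "h n \<le> (1 - t) * h u + t * h v"
      unfolding n_def using t by (intro convex_onD[OF conv]) auto
    have quad: "blinfun_apply (B (y - n)) (y - n)
        = blinfun_apply (B (y - u)) (y - u) - 2 * t * blinfun_apply (B (y - u)) (v - u)
          + t\<^sup>2 * blinfun_apply (B (v - u)) (v - u)"
    proof -
      have *: "y - n = (y - u) - t *\<^sub>R (v - u)"
        by (simp add: n_def algebra_simps)
      show ?thesis
        unfolding * using B_commute[of "v - u" "y - u"]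
        by (simp only: linear_diff[OF linear_B, of "y - u"] linear_cmul[OF linear_B]
            blinfun.diff_left blinfun.diff_right[of _ "y - u"] blinfun.scaleR_left
            blinfun.scaleR_right real_scaleR_def) (simp add: algebra_simps power2_eq_square)
    qed
    have "0 \<le> t * (s + t * q)"
      using le min[of n] unfolding quad
      by (simp add: s_def q_def algebra_simps power2_eq_square)
    then show ?thesis using t by (simp add: zero_le_mult_iff)
  qed
  then have "eventually (\<lambda>t. 0 \<le> s + t * q) (at_right 0)"
    by (auto simp: eventually_at_right_field intro!: exI[of _ 1])
  moreover have "((\<lambda>t. s + t * q) \<longlongrightarrow> s + 0 * q) (at_right 0)"
    by (intro tendsto_intros)
  ultimately have "0 \<le> s + 0 * q"
    by (intro tendsto_lowerbound) auto
  then show ?thesis by (simp add: s_def)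
qed

section \<open>The gradient of a Moreau envelope\<close>

lemma Moreau_envelope_lipschitz_gradient:
  assumes conv: "convex_on UNIV h" and L: "L > 0"
    and p_le: "\<And>y v. p y \<le> h v + L / 2 * blinfun_apply (B (y - v)) (y - v)"
    and p_eq: "\<And>y. p y = h (u y) + L / 2 * blinfun_apply (B (y - u y)) (y - u y)"
  shows "p differentiable (at x)"
    and "dual_norm B (gradient p x - gradient p y) \<le> L * primal_norm B (x - y)"
proof -
  \<comment> \<open>The candidate gradient at \<open>y\<close> is
    \<open>B (L *\<^sub>R w y)\<close>.\<close>
  define w where "w y = y - u y" for y
  have expand: "blinfun_apply (B (a + b)) (a + b)
      = blinfun_apply (B a) a + 2 * blinfun_apply (B a) b + blinfun_apply (B b) b" for a b
    using B_commute[of a b] by (simp add: B_simps)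
  \<comment> \<open>The minimizer \<open>u y\<close> for \<open>y\<close> serves as a trial point
    for the envelope at \<open>x\<close>.\<close>
  have upper: "p x \<le> p y + L * blinfun_apply (B (w y)) (x - y)
      + L / 2 * blinfun_apply (B (x - y)) (x - y)" for x y
  proof -
    have eq: "x - u y = w y + (x - y)" by (simp add: w_def)
    have "p x \<le> h (u y) + L / 2 * blinfun_apply (B (w y + (x - y))) (w y + (x - y))"
      using p_le[of x "u y"] by (simp only: eq)
    also have "\<dots> = p y + L * blinfun_apply (B (w y)) (x - y)
        + L / 2 * blinfun_apply (B (x - y)) (x - y)"
      unfolding expand p_eq[of y] w_def[symmetric] by (simp add: algebra_simps)
    finally show ?thesis .
  qed
  \<comment> \<open>The subgradient inequality at \<open>u y\<close> is tested at
    \<open>u x\<close>; expanding the square of \<open>w x\<close> around \<open>w y\<close> leaves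
    exactly the quadratic remainder.\<close>
  have lower: "p y + L * blinfun_apply (B (w y)) (x - y)
      + L / 2 * blinfun_apply (B (w x - w y)) (w x - w y) \<le> p x" for x y
  proof -
    have "h (u y) + L * blinfun_apply (B (w y)) (u x - u y) \<le> h (u x)"
      unfolding w_def using p_le[of y] p_eq[of y] by (intro prox_subgradient[OF conv]) simp
    moreover have "u x - u y = (x - y) - (w x - w y)" by (simp add: w_def)
    ultimately have "h (u y) + L * blinfun_apply (B (w y)) (x - y)
        - L * blinfun_apply (B (w y)) (w x - w y) \<le> h (u x)"
      by (simp add: blinfun.diff_right[of _ "x - y"] right_diff_distrib)
    moreover have "blinfun_apply (B (w x)) (w x) = blinfun_apply (B (w y)) (w y)
        + 2 * blinfun_apply (B (w y)) (w x - w y)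
        + blinfun_apply (B (w x - w y)) (w x - w y)"
      using expand[of "w y" "w x - w y"] by simp
    ultimately show ?thesis
      unfolding p_eq w_def[symmetric] by (simp add: algebra_simps)
  qed
  obtain K where K: "\<And>x. blinfun_apply (B x) x \<le> K * (norm x)\<^sup>2"
    using B_le_norm_power2 by blast
  have deriv: "(p has_derivative blinfun_apply (B (L *\<^sub>R w y))) (at y)" for y
  proof (rule has_derivative_if_quadratic_error)
    fix x
    have "0 \<le> L / 2 * blinfun_apply (B (w x - w y)) (w x - w y)"
      using L B_nonneg by simp
    then have "0 \<le> p x - p y - L * blinfun_apply (B (w y)) (x - y)"
      using lower[of y x] by linarith
    moreover have "p x - p y - L * blinfun_apply (B (w y)) (x - y) \<le> L / 2 * (K * (norm (x - y))\<^sup>2)"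
      using upper[of x y] mult_left_mono[OF K[of "x - y"], of "L / 2"] L by linarith
    ultimately show "\<bar>p x - p y - blinfun_apply (B (L *\<^sub>R w y)) (x - y)\<bar>
        \<le> (L / 2 * K) * (norm (x - y))\<^sup>2"
      by (simp add: linear_cmul[OF linear_B] blinfun.scaleR_left)
  qed
  then show "p differentiable (at x)"
    unfolding differentiable_def by blast
  let ?v = "x - y" and ?w = "w x - w y"
  \<comment> \<open>Co-coercivity: adding \<open>lower\<close> to its copy with \<open>x\<close> and
    \<open>y\<close> exchanged cancels the values of \<open>p\<close>.\<close>
  have "blinfun_apply (B ?w) ?w \<le> blinfun_apply (B ?w) ?v"
  proof -
    have "x - y = - (y - x)" "w x - w y = - (w y - w x)" by simp_all
    then have "blinfun_apply (B (w x)) (y - x) = - blinfun_apply (B (w x)) ?v"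
      "blinfun_apply (B (w y - w x)) (w y - w x) = blinfun_apply (B ?w) ?w"
      by (simp_all add: B_simps)
    then have "L * blinfun_apply (B ?w) ?w \<le> L * blinfun_apply (B ?w) ?v"
      using lower[of x y] lower[of y x]
      by (simp add: linear_diff[OF linear_B, of "w x"] blinfun.diff_left right_diff_distrib)
    then show ?thesis using L by simp
  qed
  \<comment> \<open>Nonnegativity of the form at \<open>?w - ?v\<close> replaces Cauchy-Schwarz:
    with co-coercivity, the right-hand side is at most the form at \<open>?v\<close> minus the form
    at \<open>?w\<close>.\<close>
  moreover have "0 \<le> blinfun_apply (B ?w) ?w - 2 * blinfun_apply (B ?w) ?v + blinfun_apply (B ?v) ?v"
  proof -
    have "blinfun_apply (B (- ?v)) (- ?v) = blinfun_apply (B ?v) ?v"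
      by (simp add: B_simps)
    then show ?thesis
      using B_nonneg[of "?w + - ?v"] expand[of ?w "- ?v"]
      by (simp only: blinfun.minus_right)
  qed
  ultimately have "primal_norm B ?w \<le> primal_norm B ?v"
    unfolding primal_norm_def by simp
  moreover have "dual_norm B (gradient p x - gradient p y) = L * primal_norm B ?w"
  proof -
    have "gradient p x - gradient p y = B (L *\<^sub>R ?w)"
      unfolding gradient_eqI[OF deriv]
      by (simp only: linear_diff[OF linear_B, symmetric] scaleR_right_diff_distrib)
    moreover have "primal_norm B (L *\<^sub>R v) = L * primal_norm B v" for v
      using L by (simp add: primal_norm_def B_simps real_sqrt_mult)
    ultimately show ?thesis
      by (simp only: dual_norm_B)
  qed
  ultimately show "dual_norm B (gradient p x - gradient p y) \<le> L * primal_norm B (x - y)"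
    using L by simp
qed

section \<open>The model as a Moreau envelope of a piecewise affine function\<close>

lemma phi_eq_prox_objective:
  assumes L: "L > 0" and m: "m \<ge> 1"
  shows "phi B f L m z y (B (L *\<^sub>R (y - u)))
    = (MAX i\<in>{1..m}. blinfun_apply (gradient f (z i)) u
        + (f (z i) - blinfun_apply (gradient f (z i)) (z i)
           + 1 / (2 * L) * (dual_norm B (gradient f (z i)))\<^sup>2))
      + L / 2 * blinfun_apply (B (y - u)) (y - u)"
proof -
  define G where "G i = gradient f (z i)" for i
  define d where "d = y - u"
  \<comment> \<open>For \<open>g = G i\<close>, the cross term of the expanded square turns the
    pairing of \<open>G i\<close> with \<open>y - z i\<close> into its pairing with
    \<open>u - z i\<close>. The only remaining dependence on \<open>y\<close> is the form at
    \<open>d\<close>, which is common to all \<open>i\<close> and leaves the maximum.\<close>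
  have sq: "1 / (2 * L) * (dual_norm B (B (L *\<^sub>R d) - g))\<^sup>2
      = L / 2 * blinfun_apply (B d) d - blinfun_apply g d + 1 / (2 * L) * (dual_norm B g)\<^sup>2" for g
  proof -
    obtain v where v: "g = B v" using surj_B by (metis surjD)
    have "(dual_norm B (B (L *\<^sub>R d) - g))\<^sup>2
        = L\<^sup>2 * blinfun_apply (B d) d - 2 * L * blinfun_apply g d + (dual_norm B g)\<^sup>2"
      unfolding v linear_diff[OF linear_B, symmetric] dual_norm_B primal_norm_power2
      using B_commute[of d v] by (simp add: B_simps algebra_simps power2_eq_square)
    then show ?thesis
      using L by (simp add: field_simps power2_eq_square)
  qed
  have "phi B f L m z y (B (L *\<^sub>R d))
    = (MAX i\<in>{1..m}. (blinfun_apply (G i) u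
        + (f (z i) - blinfun_apply (G i) (z i) + 1 / (2 * L) * (dual_norm B (G i))\<^sup>2))
      + L / 2 * blinfun_apply (B d) d)"
    unfolding phi_def G_def[symmetric] sq by (simp add: d_def blinfun.diff_right algebra_simps)
  also have "\<dots> = (MAX i\<in>{1..m}. blinfun_apply (G i) u
        + (f (z i) - blinfun_apply (G i) (z i) + 1 / (2 * L) * (dual_norm B (G i))\<^sup>2))
      + L / 2 * blinfun_apply (B d) d"
    using m by (intro Max_add_commute) auto
  finally show ?thesis by (simp add: G_def d_def)
qed

end

theorem proposition2p5:
  fixes B :: "'a::euclidean_space \<Rightarrow> ('a \<Rightarrow>\<^sub>L real)"
    and f :: "'a \<Rightarrow> real"
    and L :: real
    and m :: nat
    and z :: "nat \<Rightarrow> 'a"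
  assumes "sym_pos_def B"
    and "convex_on UNIV f"
    and "\<forall>x. f differentiable (at x)"
    and "L > 0"
    and "\<forall>x y. dual_norm B (gradient f x - gradient f y) \<le> L * primal_norm B (x - y)"
    and "m \<ge> 1"
  shows "(\<forall>x. p_model B f L m z differentiable (at x))
    \<and> (\<forall>x y. dual_norm B (gradient (p_model B f L m z) x - gradient (p_model B f L m z) y)
              \<le> L * primal_norm B (x - y))"
proof -
  interpret euclidean_metric B
    by unfold_locales fact
  define c where "c i = f (z i) - blinfun_apply (gradient f (z i)) (z i)
      + 1 / (2 * L) * (dual_norm B (gradient f (z i)))\<^sup>2" for i
  define h where "h u = (MAX i\<in>{1..m}. blinfun_apply (gradient f (z i)) u + c i)" for u
  have conv: "convex_on UNIV h"
    unfolding h_def using \<open>m \<ge> 1\<close> by (intro convex_on_Max_affine) auto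
  then have cont: "continuous_on UNIV h"
    by (intro convex_on_continuous) auto
  \<comment> \<open>Any affine piece bounds the maximum from below; index 1 is available since
    \<open>m \<ge> 1\<close>.\<close>
  have minorant: "blinfun_apply (gradient f (z 1)) u + c 1 \<le> h u" for u
    unfolding h_def using \<open>m \<ge> 1\<close> by (intro Max_ge) auto
  have "\<exists>u. \<forall>v. h u + L / 2 * blinfun_apply (B (y - u)) (y - u)
      \<le> h v + L / 2 * blinfun_apply (B (y - v)) (y - v)" for y
    using prox_exists[OF cont \<open>L > 0\<close> minorant] by blast
  then obtain u where u: "\<And>y v. h (u y) + L / 2 * blinfun_apply (B (y - u y)) (y - u y)
      \<le> h v + L / 2 * blinfun_apply (B (y - v)) (y - v)"
    by metis
  have phi: "phi B f L m z y (B (L *\<^sub>R (y - v)))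
      = h v + L / 2 * blinfun_apply (B (y - v)) (y - v)" for y v
    using phi_eq_prox_objective[OF \<open>L > 0\<close> \<open>m \<ge> 1\<close>] by (simp add: h_def c_def)
  have p_eq: "p_model B f L m z y = h (u y) + L / 2 * blinfun_apply (B (y - u y)) (y - u y)" for y
    unfolding p_model_def
  proof (rule Least_equality)
    show "h (u y) + L / 2 * blinfun_apply (B (y - u y)) (y - u y) \<in> range (phi B f L m z y)"
      unfolding phi[symmetric] by (rule rangeI)
  next
    fix r assume "r \<in> range (phi B f L m z y)"
    then obtain g where g: "r = phi B f L m z y g" by blast
    obtain w where "g = B w" using surj_B by (metis surjD)
    \<comment> \<open>Every dual vector arises from the substitution, so minimizing over
      \<open>g\<close> is the same as minimizing over the proximal variable. The minimum is
      attained, which gives \<open>LEAST\<close> its intended value.\<close>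
    then have "g = B (L *\<^sub>R (y - (y - (1 / L) *\<^sub>R w)))"
      using \<open>L > 0\<close> by simp
    then show "h (u y) + L / 2 * blinfun_apply (B (y - u y)) (y - u y) \<le> r"
      using u g by (simp only: phi)
  qed
  have p_le: "p_model B f L m z y \<le> h v + L / 2 * blinfun_apply (B (y - v)) (y - v)" for y v
    unfolding p_eq by (rule u)
  show ?thesis
    using Moreau_envelope_lipschitz_gradient[OF conv \<open>L > 0\<close> p_le p_eq] by blast
qed

end
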